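(* For all integers $n\ge 0$, $$H_{n+1,\lambda}^{Y}(x)=x\sum_{k=0}^{n}\binom{n}{k}E\big[\langle Y\rangle_{k+1,\lambda}\big]H_{n-k,\lambda}^{Y}(x).$$
   Context: Let $Y$ be a real random variable with $E[|Y|^{n}]<\infty$ for all integers $n\ge 0$ and $\lim_{n\to\infty}|t|^{n}E[|Y|^{n}]/n!=0$ for $|t|<r$, for some $r>0$. Fix a nonzero real $\lambda$. Put $\langle x\rangle_{0,\lambda}=1$, $\langle x\rangle_{n,\lambda}=x(x+\lambda)\cdots(x+(n-1)\lambda)$, and $e_\lambda^{-Y}(-t)=(1-\lambda t)^{-Y/\lambda}$, so $E[e_\lambda^{-Y}(-t)]=\sum_{n\ge0}E[\langle Y\rangle_{n,\lambda}]t^n/n!$ near $t=0$. The probabilistic heterogeneous Bell polynomials $H^Y_{n,\lambda}(x)$ are defined by $e^{x(E[e_{\lambda}^{-Y}(-t)]-1)}=\sum_{n\ge0}H_{n,\lambda}^{Y}(x)t^{n}/n!$. *)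

theory Defs
  imports "HOL-Probability.Probability" "HOL-Analysis.FPS_Convergence"
begin

definition deg_rising :: "real \<Rightarrow> nat \<Rightarrow> real \<Rightarrow> real" where
  "deg_rising l n x = (\<Prod>i<n. x + real i * l)"

text \<open>The degenerate exponential \<open>e\<^sub>\<lambda>\<^sup>a(t) = (1 + \<lambda> t)\<^bsup>a/\<lambda>\<^esup>\<close>. It is the
  intended real power only where \<open>1 + \<lambda> t > 0\<close>; below it is only used for \<open>t\<close> near 0.\<close>

definition deg_exp :: "real \<Rightarrow> real \<Rightarrow> real \<Rightarrow> real" where
  "deg_exp l a t = (1 + l * t) powr (a / l)"

definition bell_gen :: "'a measure \<Rightarrow> ('a \<Rightarrow> real) \<Rightarrow> real \<Rightarrow> real \<Rightarrow> real \<Rightarrow> real" where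
  "bell_gen M Y l x t = exp (x * ((\<integral>\<omega>. deg_exp l (- Y \<omega>) (- t) \<partial>M) - 1))"

text \<open>\<open>H\<^sub>n(x)\<close> is \<open>n!\<close> times the coefficient of \<open>t\<^sup>n\<close> in the unique power series with positive
  radius of convergence that represents the generating function \<^const>\<open>bell_gen\<close> in a
  neighbourhood of \<open>t = 0\<close>.\<close>

definition het_bell :: "'a measure \<Rightarrow> ('a \<Rightarrow> real) \<Rightarrow> real \<Rightarrow> nat \<Rightarrow> real \<Rightarrow> real" where
  "het_bell M Y l n x = fact n * fps_nth (THE F. bell_gen M Y l x has_fps_expansion F) n"

end

theory Submission
  imports Defs "HOL-Complex_Analysis.Laurent_Convergence"
begin

text \<open>With \<open>G(t) = E[e\<^sub>\<lambda>\<^sup>-\<^sup>Y(-t)]\<close>, the generating function \<open>F = exp (x (G - 1))\<close> satisfies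
  \<open>F' = x G' F\<close>; comparing coefficients gives the recurrence. The analytic content is that \<open>G\<close> may be
  expanded termwise: the series \<open>\<Sum>\<^sub>n \<langle>Y\<rangle>\<^sub>n t\<^sup>n / n!\<close> is dominated by the same series for
  \<open>|Y|\<close>, \<open>|\<lambda>|\<close>, \<open>|t|\<close>, whose sum is \<open>exp (s |Y|)\<close> with \<open>s = -ln (1 - |\<lambda>t|) / |\<lambda>|\<close>, and the moment
  condition makes this integrable once \<open>s < r\<close>.\<close>

section \<open>Real power series expansions\<close>

lemma has_fps_expansion_nth_conv_deriv:
  fixes f :: "real \<Rightarrow> real"
  assumes "f has_fps_expansion F"
  shows "fps_nth F n = (deriv ^^ n) f 0 / fact n"
  using assms
proof (induction n arbitrary: f F)
  case 0
  then show ?case by (simp add: has_fps_expansion_imp_0_eq_fps_nth_0)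
next
  case (Suc n)
  have "fps_nth (fps_deriv F) n = (deriv ^^ n) (deriv f) 0 / fact n"
    by (intro Suc.IH has_fps_expansion_deriv Suc.prems)
  then show ?case
    by (simp add: funpow_Suc_right field_simps del: funpow.simps of_nat_Suc)
qed

text \<open>The coefficients are derivatives of \<open>f\<close> at 0, so \<open>f\<close>
  determines them. This is what makes the \<open>THE\<close> in \<open>het_bell\<close> denote a
  definite series.\<close>

lemma fps_expansion_unique_real:
  fixes f :: "real \<Rightarrow> real"
  assumes "f has_fps_expansion F" "f has_fps_expansion G"
  shows "F = G"
  using assms by (simp add: fps_eq_iff has_fps_expansion_nth_conv_deriv)

text \<open>Real series are embedded coefficientwise so that the complex result
  \<open>has_fps_expansion_compose\<close> can be applied to them.\<close>

definition fps_complex_of_real :: "real fps \<Rightarrow> complex fps" where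
  "fps_complex_of_real F = Abs_fps (\<lambda>n. complex_of_real (fps_nth F n))"

lemma fps_nth_complex_of_real [simp]:
  "fps_nth (fps_complex_of_real F) n = complex_of_real (fps_nth F n)"
  by (simp add: fps_complex_of_real_def)

lemma fps_complex_of_real_mult:
  "fps_complex_of_real (F * G) = fps_complex_of_real F * fps_complex_of_real G"
  by (simp add: fps_eq_iff fps_mult_nth)

lemma fps_complex_of_real_power:
  "fps_complex_of_real (F ^ n) = fps_complex_of_real F ^ n"
proof (induction n)
  case 0
  show ?case by (simp add: fps_eq_iff)
next
  case (Suc n)
  then show ?case by (simp add: fps_complex_of_real_mult)
qed

lemma fps_complex_of_real_compose:
  "fps_complex_of_real (F oo G) = fps_complex_of_real F oo fps_complex_of_real G"
  by (simp add: fps_eq_iff fps_compose_nth flip: fps_complex_of_real_power)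

lemma fps_conv_radius_complex_of_real [simp]:
  "fps_conv_radius (fps_complex_of_real F) = fps_conv_radius F"
  by (simp add: fps_conv_radius_def conv_radius_def)

lemma eval_fps_complex_of_real:
  assumes "ereal \<bar>u\<bar> < fps_conv_radius F"
  shows "eval_fps (fps_complex_of_real F) (complex_of_real u) = complex_of_real (eval_fps F u)"
proof -
  have "(\<lambda>n. fps_nth F n * u ^ n) sums eval_fps F u"
    unfolding eval_fps_def using summable_fps[of u F] assms by (simp add: summable_sums)
  then have "(\<lambda>n. complex_of_real (fps_nth F n * u ^ n)) sums complex_of_real (eval_fps F u)"
    by (simp only: sums_of_real_iff)
  then show ?thesis
    unfolding eval_fps_def[of "fps_complex_of_real F"] by (simp add: sums_iff)
qed

lemma eventually_less_fps_conv_radius: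
  fixes g :: "real \<Rightarrow> real"
  assumes "(g \<longlongrightarrow> 0) A" "fps_conv_radius F > 0"
  shows "eventually (\<lambda>u. ereal \<bar>g u\<bar> < fps_conv_radius (F :: real fps)) A"
proof -
  have "((\<lambda>u. ereal \<bar>g u\<bar>) \<longlongrightarrow> ereal \<bar>0\<bar>) A"
    by (intro tendsto_intros assms)
  then show ?thesis
    using assms(2) by (intro order_tendstoD(2)) (auto simp: zero_ereal_def)
qed

text \<open>The series are composed over the complex numbers, and the resulting identity is
  restricted to the real axis.\<close>

lemma has_fps_expansion_compose_real:
  fixes f g :: "real \<Rightarrow> real"
  assumes F: "f has_fps_expansion F"
  assumes G: "g has_fps_expansion G" "fps_nth G 0 = 0"
  shows "(\<lambda>u. f (g u)) has_fps_expansion (F oo G)"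
proof -
  let ?c = fps_complex_of_real
  have rad: "fps_conv_radius F > 0" "fps_conv_radius G > 0"
    using F G by (auto simp: has_fps_expansion_def)
  \<comment> \<open>\<open>f\<close> and \<open>g\<close> live on the reals only, so the sums of the
    complexified series stand in for them.\<close>
  have "(eval_fps (?c F) \<circ> eval_fps (?c G)) has_fps_expansion (?c F oo ?c G)"
    by (intro has_fps_expansion_compose eval_fps_has_fps_expansion) (use rad G in auto)
  then have "(eval_fps (?c F) \<circ> eval_fps (?c G)) has_fps_expansion ?c (F oo G)"
    by (simp add: fps_complex_of_real_compose)
  then have radFG: "fps_conv_radius (F oo G) > 0"
    and ev: "\<forall>\<^sub>F z in nhds 0. eval_fps (?c (F oo G)) z = eval_fps (?c F) (eval_fps (?c G) z)"
    by (auto simp: has_fps_expansion_def)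
  have id0: "((\<lambda>u::real. u) \<longlongrightarrow> 0) (nhds 0)"
    by (rule filterlim_ident)
  have "filterlim complex_of_real (nhds 0) (nhds 0)"
    using tendsto_of_real[OF id0, where 'a = complex] by simp
  with ev have ev_real: "\<forall>\<^sub>F u in nhds 0. eval_fps (?c (F oo G)) (complex_of_real u) =
      eval_fps (?c F) (eval_fps (?c G) (complex_of_real u))"
    by (rule eventually_compose_filterlim)
  have "continuous (at 0) g"
    using G(1) by (rule has_fps_expansion_imp_continuous)
  \<comment> \<open>\<open>nhds 0\<close> contains the point 0 itself, so the limit of
    \<open>g\<close> along it needs the value there as well as continuity.\<close>
  moreover have "g 0 = 0"
    using has_fps_expansion_imp_0_eq_fps_nth_0[OF G(1)] G(2) by simp
  ultimately have g0: "(g \<longlongrightarrow> 0) (nhds 0)"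
    by (metis continuous_within tendsto_nhds_iff)
  have evF: "\<forall>\<^sub>F u in nhds 0. eval_fps F (g u) = f (g u)"
    using eventually_compose_filterlim[OF _ g0] F by (auto simp: has_fps_expansion_def)
  have evG: "\<forall>\<^sub>F u in nhds 0. eval_fps G u = g u"
    using G unfolding has_fps_expansion_def by blast
  have "\<forall>\<^sub>F u in nhds 0. eval_fps (F oo G) u = f (g u)"
    \<comment> \<open>Passing from complex to real sums needs the argument inside the disc of
      convergence, once for each of the three series; for \<open>F\<close> the argument is
      \<open>g u\<close>.\<close>
    using ev_real evF evG
      eventually_less_fps_conv_radius[OF id0 radFG]
      eventually_less_fps_conv_radius[OF id0 rad(2)]
      eventually_less_fps_conv_radius[OF g0 rad(1)]
    by eventually_elim (simp add: eval_fps_complex_of_real)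
  with radFG show ?thesis by (simp add: has_fps_expansion_def)
qed

text \<open>The chain rule gives F' = x G' F for F = exp(x G), and the claim compares coefficients
  of degree \<open>n\<close>. The constant term of \<open>G\<close> must vanish for the formal chain
  rule.\<close>

lemma fps_exp_compose_nth_Suc:
  fixes G :: "'a :: field_char_0 fps"
  assumes "fps_nth G 0 = 0"
  shows "of_nat (Suc n) * fps_nth (fps_exp x oo G) (Suc n) =
    x * (\<Sum>k=0..n. of_nat (Suc k) * fps_nth G (Suc k) * fps_nth (fps_exp x oo G) (n - k))"
proof -
  let ?F = "fps_exp x oo G"
  have "fps_deriv ?F = fps_const x * (fps_deriv G * ?F)"
    using assms by (simp add: fps_compose_deriv fps_compose_mult_distrib mult_ac)
  then have "fps_nth (fps_deriv ?F) n = x * fps_nth (fps_deriv G * ?F) n"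
    by simp
  then show ?thesis by (simp add: fps_mult_nth)
qed

section \<open>Termwise expansion of the expected degenerate exponential\<close>

text \<open>Pulling \<open>- l\<close> out of each factor, y + i l = (-y/l - i)(-l), turns the
  rising product into a falling one, so that the binomial series applies.\<close>

lemma deg_rising_conv_gbinomial:
  assumes "l \<noteq> 0"
  shows "deg_rising l n y / fact n = ((- y / l) gchoose n) * (- l) ^ n"
proof -
  have "deg_rising l n y = (\<Prod>i<n. (- y / l - real i) * (- l))"
    unfolding deg_rising_def using assms by (intro prod.cong) (auto simp: field_simps)
  also have "\<dots> = (\<Prod>i<n. - y / l - real i) * (- l) ^ n"
    by (simp only: prod.distrib prod_constant card_lessThan)
  finally show ?thesis
    by (simp add: gbinomial_prod_rev atLeast0LessThan)
qed

lemma deg_exp_sums: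
  assumes "l \<noteq> 0" "\<bar>l * t\<bar> < 1"
  shows "(\<lambda>n. deg_rising l n y / fact n * t ^ n) sums deg_exp l (- y) (- t)"
proof -
  have "(\<lambda>n. ((- y / l) gchoose n) * (- l * t) ^ n) sums (1 + (- l * t)) powr (- y / l)"
    using assms by (intro gen_binomial_real) simp
  moreover have "((- y / l) gchoose n) * (- l * t) ^ n = deg_rising l n y / fact n * t ^ n" for n
    unfolding deg_rising_conv_gbinomial[OF assms(1)] power_mult_distrib by simp
  ultimately show ?thesis
    by (simp add: deg_exp_def)
qed

lemma abs_deg_rising_le: "\<bar>deg_rising l n y\<bar> \<le> deg_rising \<bar>l\<bar> n \<bar>y\<bar>"
  unfolding deg_rising_def abs_prod
proof (intro prod_mono conjI)
  fix i
  show "\<bar>y + real i * l\<bar> \<le> \<bar>y\<bar> + real i * \<bar>l\<bar>"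
    using abs_triangle_ineq[of y "real i * l"] by (simp add: abs_mult)
qed simp

text \<open>The absolute values are dominated by the nonnegative terms of a binomial series with sum
  (1 - |l t|) to the power -|y|/|l|. The bound does not depend on \<open>N\<close>, so one
  integrable function will dominate all partial sums.\<close>

lemma abs_deg_rising_sum_le_exp:
  assumes "l \<noteq> 0" "\<bar>l * t\<bar> < 1"
  shows "(\<Sum>n<N. \<bar>deg_rising l n y / fact n * t ^ n\<bar>) \<le> exp (- ln (1 - \<bar>l * t\<bar>) / \<bar>l\<bar> * \<bar>y\<bar>)"
proof -
  let ?h = "\<lambda>n. deg_rising \<bar>l\<bar> n (\<bar>y\<bar>) / fact n * \<bar>t\<bar> ^ n"
  have le: "\<bar>deg_rising l n y / fact n * t ^ n\<bar> \<le> ?h n" for n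
    using abs_deg_rising_le[of l n y]
    by (simp add: abs_mult power_abs divide_right_mono mult_right_mono)
  have "?h sums deg_exp \<bar>l\<bar> (- \<bar>y\<bar>) (- \<bar>t\<bar>)"
    using assms by (intro deg_exp_sums) (auto simp: abs_mult)
  moreover have "0 \<le> ?h n" for n
    using le[of n] by linarith
  ultimately have "(\<Sum>n<N. ?h n) \<le> deg_exp \<bar>l\<bar> (- \<bar>y\<bar>) (- \<bar>t\<bar>)"
    using sum_le_suminf[of ?h "{..<N}"] by (simp add: sums_iff)
  also have "\<dots> = exp (- ln (1 - \<bar>l * t\<bar>) / \<bar>l\<bar> * \<bar>y\<bar>)"
    using assms by (auto simp: deg_exp_def powr_def abs_mult)
  finally have "(\<Sum>n<N. ?h n) \<le> \<dots>" .
  moreover have "(\<Sum>n<N. \<bar>deg_rising l n y / fact n * t ^ n\<bar>) \<le> (\<Sum>n<N. ?h n)"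
    by (intro sum_mono le)
  ultimately show ?thesis by (rule order_trans[rotated])
qed

text \<open>Convergence to 0 is used only as boundedness, at a point \<open>t\<close> strictly
  between \<open>s\<close> and \<open>r\<close>. Abel's lemma then gives absolute convergence at
  \<open>s\<close>, which allows the exponential series to be integrated term by term.\<close>

lemma integrable_exp_abs_moments:
  fixes Y :: "'a \<Rightarrow> real"
  assumes int: "\<And>m::nat. integrable M (\<lambda>\<omega>. \<bar>Y \<omega>\<bar> ^ m)"
    and lim: "\<And>t::real. \<bar>t\<bar> < r \<Longrightarrow>
           (\<lambda>m. \<bar>t\<bar> ^ m * (\<integral>\<omega>. \<bar>Y \<omega>\<bar> ^ m \<partial>M) / fact m) \<longlonglongrightarrow> 0"
    and s: "0 \<le> s" "s < r"
  shows "integrable M (\<lambda>\<omega>. exp (s * \<bar>Y \<omega>\<bar>))"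
proof -
  let ?E = "\<lambda>m. (\<integral>\<omega>. \<bar>Y \<omega>\<bar> ^ m \<partial>M) / fact m"
  obtain t where t: "s < t" "t < r"
    using s dense by blast
  have "convergent (\<lambda>m. t ^ m * (\<integral>\<omega>. \<bar>Y \<omega>\<bar> ^ m \<partial>M) / fact m)"
    using lim[of t] s t by (auto intro: convergentI)
  then have "Bseq (\<lambda>m. t ^ m * (\<integral>\<omega>. \<bar>Y \<omega>\<bar> ^ m \<partial>M) / fact m)"
    by (rule convergent_imp_Bseq)
  then obtain K where K: "\<And>m. norm (t ^ m * (\<integral>\<omega>. \<bar>Y \<omega>\<bar> ^ m \<partial>M) / fact m) \<le> K"
    unfolding Bseq_def by blast
  have "norm (?E m) * t ^ m \<le> K" for m
    using K[of m] s t by (simp add: abs_mult mult.commute)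
  then have summable: "summable (\<lambda>m. norm (?E m) * s ^ m)"
    by (intro Abel_lemma[of s t]) (use s t in auto)
  have exp_sums: "(\<lambda>m. s ^ m / fact m * \<bar>Y \<omega>\<bar> ^ m) sums exp (s * \<bar>Y \<omega>\<bar>)" for \<omega>
    using exp_converges[of "s * \<bar>Y \<omega>\<bar>"] by (simp add: power_mult_distrib field_simps)
  have "integrable M (\<lambda>\<omega>. \<Sum>m. s ^ m / fact m * \<bar>Y \<omega>\<bar> ^ m)"
  proof (rule integrable_suminf)
    show "integrable M (\<lambda>\<omega>. s ^ m / fact m * \<bar>Y \<omega>\<bar> ^ m)" for m
      by (intro integrable_mult_right int)
    show "AE \<omega> in M. summable (\<lambda>m. norm (s ^ m / fact m * \<bar>Y \<omega>\<bar> ^ m))"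
      using exp_sums s by (auto simp: abs_mult sums_iff)
    show "summable (\<lambda>m. \<integral>\<omega>. norm (s ^ m / fact m * \<bar>Y \<omega>\<bar> ^ m) \<partial>M)"
      using summable s by (simp add: abs_mult mult.commute)
  qed
  then show ?thesis
    using exp_sums by (simp add: sums_iff)
qed

lemma expectation_deg_exp_has_fps_expansion:
  fixes Y :: "'a \<Rightarrow> real"
  assumes [measurable]: "Y \<in> borel_measurable M"
    and int: "\<And>m::nat. integrable M (\<lambda>\<omega>. \<bar>Y \<omega>\<bar> ^ m)"
    and "r > 0"
    and lim: "\<And>t::real. \<bar>t\<bar> < r \<Longrightarrow>
           (\<lambda>m. \<bar>t\<bar> ^ m * (\<integral>\<omega>. \<bar>Y \<omega>\<bar> ^ m \<partial>M) / fact m) \<longlonglongrightarrow> 0"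
    and "l \<noteq> 0"
  shows "(\<lambda>t. \<integral>\<omega>. deg_exp l (- Y \<omega>) (- t) \<partial>M) has_fps_expansion
    Abs_fps (\<lambda>n. (\<integral>\<omega>. deg_rising l n (Y \<omega>) \<partial>M) / fact n)"
proof (rule has_fps_expansionI)
  let ?s = "\<lambda>t. - ln (1 - \<bar>l * t\<bar>) / \<bar>l\<bar>"
  \<comment> \<open>The limit is 0 because ln 1 = 0, so \<open>?s t\<close> falls below
    \<open>r\<close> near 0 and the exponential moment exists.\<close>
  have "(?s \<longlongrightarrow> - ln (1 - \<bar>l * 0\<bar>) / \<bar>l\<bar>) (nhds 0)"
    using \<open>l \<noteq> 0\<close> by (intro tendsto_intros filterlim_ident) auto
  then have ev_s: "\<forall>\<^sub>F t in nhds 0. ?s t < r"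
    by (rule order_tendstoD) (use \<open>r > 0\<close> in simp)
  have "((\<lambda>t. \<bar>l * t\<bar>) \<longlongrightarrow> \<bar>l * 0\<bar>) (nhds 0)"
    by (intro tendsto_intros filterlim_ident)
  then have ev_1: "\<forall>\<^sub>F t in nhds 0. \<bar>l * t\<bar> < 1"
    by (rule order_tendstoD) simp
  show "\<forall>\<^sub>F t in nhds 0.
      (\<lambda>n. fps_nth (Abs_fps (\<lambda>n. (\<integral>\<omega>. deg_rising l n (Y \<omega>) \<partial>M) / fact n)) n * t ^ n)
        sums (\<integral>\<omega>. deg_exp l (- Y \<omega>) (- t) \<partial>M)"
    using ev_s ev_1
  proof eventually_elim
    case (elim t)
    let ?f = "\<lambda>n \<omega>. deg_rising l n (Y \<omega>) / fact n * t ^ n"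
    have bound: "(\<Sum>n<N. \<bar>?f n \<omega>\<bar>) \<le> exp (?s t * \<bar>Y \<omega>\<bar>)" for N \<omega>
      by (intro abs_deg_rising_sum_le_exp elim \<open>l \<noteq> 0\<close>)
    have "0 \<le> ?s t"
      using elim(2) by (intro divide_nonneg_nonneg) auto
    then have int_exp: "integrable M (\<lambda>\<omega>. exp (?s t * \<bar>Y \<omega>\<bar>))"
      using elim(1) by (intro integrable_exp_abs_moments[OF int lim])
    have int_f: "integrable M (?f n)" for n
    proof (rule Bochner_Integration.integrable_bound[OF int_exp])
      show "?f n \<in> borel_measurable M"
        unfolding deg_rising_def by measurable
      \<comment> \<open>A single term is at most the partial sum ending in it, so the bound on
        partial sums covers it too.\<close>
      have "\<bar>?f n \<omega>\<bar> \<le> (\<Sum>k<Suc n. \<bar>?f k \<omega>\<bar>)" for \<omega>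
        by (simp add: sum_nonneg)
      then have "\<bar>?f n \<omega>\<bar> \<le> exp (?s t * \<bar>Y \<omega>\<bar>)" for \<omega>
        using bound by (rule order_trans)
      then show "AE \<omega> in M. norm (?f n \<omega>) \<le> norm (exp (?s t * \<bar>Y \<omega>\<bar>))"
        unfolding real_norm_def abs_exp_cancel by (rule AE_I2)
    qed
    have "(\<lambda>n. integral\<^sup>L M (?f n)) sums (\<integral>\<omega>. (\<Sum>n. ?f n \<omega>) \<partial>M)"
    proof (rule sums_integral[OF int_f])
      show "AE \<omega> in M. summable (\<lambda>n. norm (?f n \<omega>))"
        using bound by (intro AE_I2 summableI_nonneg_bounded) auto
      \<comment> \<open>All partial sums are bounded by the one exponential moment
        E[exp(s |Y|)].\<close>
      show "summable (\<lambda>n. \<integral>\<omega>. norm (?f n \<omega>) \<partial>M)"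
      proof (rule summableI_nonneg_bounded)
        fix N
        have "(\<Sum>n<N. \<integral>\<omega>. norm (?f n \<omega>) \<partial>M) = (\<integral>\<omega>. (\<Sum>n<N. \<bar>?f n \<omega>\<bar>) \<partial>M)"
          unfolding real_norm_def
          by (intro Bochner_Integration.integral_sum[symmetric] integrable_abs int_f)
        also have "\<dots> \<le> (\<integral>\<omega>. exp (?s t * \<bar>Y \<omega>\<bar>) \<partial>M)"
          by (intro integral_mono Bochner_Integration.integrable_sum integrable_abs int_f int_exp bound)
        finally show "(\<Sum>n<N. \<integral>\<omega>. norm (?f n \<omega>) \<partial>M) \<le> (\<integral>\<omega>. exp (?s t * \<bar>Y \<omega>\<bar>) \<partial>M)" .
      qed simp
    qed
    moreover have "(\<Sum>n. ?f n \<omega>) = deg_exp l (- Y \<omega>) (- t)" for \<omega>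
      using deg_exp_sums[OF \<open>l \<noteq> 0\<close> elim(2)] by (simp add: sums_iff)
    ultimately show ?case by simp
  qed
qed

theorem theorem2p7:
  fixes M :: "'a measure" and Y :: "'a \<Rightarrow> real" and r l x :: real and n :: nat
  assumes "prob_space M"
    and "Y \<in> borel_measurable M"
    and "\<And>m::nat. integrable M (\<lambda>\<omega>. \<bar>Y \<omega>\<bar> ^ m)"
    and "r > 0"
    and "\<And>t::real. \<bar>t\<bar> < r \<Longrightarrow>
           (\<lambda>m. \<bar>t\<bar> ^ m * (\<integral>\<omega>. \<bar>Y \<omega>\<bar> ^ m \<partial>M) / fact m) \<longlonglongrightarrow> 0"
    and "l \<noteq> 0"
  shows "het_bell M Y l (n + 1) x =
    x * (\<Sum>k=0..n. real (n choose k) * (\<integral>\<omega>. deg_rising l (k + 1) (Y \<omega>) \<partial>M) * het_bell M Y l (n - k) x)"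
proof -
  interpret prob_space M by fact
  define e where "e n = (\<integral>\<omega>. deg_rising l n (Y \<omega>) \<partial>M)" for n
  define G where "G = Abs_fps (\<lambda>n. e n / fact n) - 1"
  define F where "F = fps_exp x oo G"
  have "(\<lambda>t. (\<integral>\<omega>. deg_exp l (- Y \<omega>) (- t) \<partial>M) - 1) has_fps_expansion G"
    unfolding G_def e_def
    by (intro has_fps_expansion_diff has_fps_expansion_1
        expectation_deg_exp_has_fps_expansion[OF assms(2-6)])
  \<comment> \<open>The empty product is 1 and the total mass is 1, so the subtracted 1 cancels the
    constant term exactly.\<close>
  moreover have G0: "fps_nth G 0 = 0"
    by (simp add: G_def e_def deg_rising_def prob_space)
  ultimately have "bell_gen M Y l x has_fps_expansion F"
    unfolding bell_gen_def F_def
    by (intro has_fps_expansion_compose_real[OF has_fps_expansion_exp])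
  then have "(THE F. bell_gen M Y l x has_fps_expansion F) = F"
    by (blast intro: fps_expansion_unique_real)
  then have H: "het_bell M Y l m x = fact m * fps_nth F m" for m
    by (simp add: het_bell_def)
  \<comment> \<open>The factor k + 1 from differentiation reduces (k + 1)! to k!; the subtracted 1
    does not affect positive degrees.\<close>
  have G_Suc: "real (Suc k) * fps_nth G (Suc k) = e (Suc k) / fact k" for k
    by (simp add: G_def field_simps del: of_nat_Suc)
  have "het_bell M Y l (n + 1) x = fact n * (real (Suc n) * fps_nth F (Suc n))"
    by (simp add: H)
  also have "\<dots> = fact n * (x * (\<Sum>k=0..n. e (Suc k) / fact k * fps_nth F (n - k)))"
    unfolding F_def by (subst fps_exp_compose_nth_Suc[OF G0]) (simp only: G_Suc)
  also have "\<dots> = x * (\<Sum>k=0..n. fact n * (e (Suc k) / fact k * fps_nth F (n - k)))"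
    by (simp add: sum_distrib_left mult.left_commute)
  \<comment> \<open>Here n!/k! splits as the binomial coefficient times (n - k)!, and the latter is
    the normalisation of \<open>het_bell\<close> at index n - k.\<close>
  also have "\<dots> = x * (\<Sum>k=0..n. real (n choose k) * e (Suc k) * het_bell M Y l (n - k) x)"
    by (intro arg_cong[where f = "(*) x"] sum.cong)
      (auto simp: H binomial_fact field_simps)
  finally show ?thesis by (simp add: e_def)
qed

end
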